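(* Let $\sigma>0$. (i) Let the sequence $(s_d,k_d, a_d)_{d\geq 1}$ be such that $$a_d^2 \geq \sigma^2\big(16\sqrt{k_d\log(d)} + 80 \log(d)\big)$$ for all $d$ large enough. Then each of the following two selectors $\hat\eta$: the thresholding selector $\hat\eta_j=\mathbf{1}(X_j\ge t_d)$, $j=1,\dots,d$, with $t_d= \sigma^2(k_d + 4 \log(d) + 4 \sqrt{k_d\log(d)})$, and the scan selector $\hat\eta =\hat{\eta}^{(s_d)}_*$, satisfies $$\limsup_{d\to \infty} \sup_{\theta \in \Theta_{k_d,d} (s_d,a_d)} \mathbf{E}_\theta |\hat \eta - \eta(\theta)| =0\quad\text{and}\quad \limsup_{d\to \infty} \sup_{\theta \in \Theta_{k_d,d} (s_d,a_d)} \mathbf{P}_\theta (S_{\hat \eta} \ne S_{\eta(\theta)}) =0.$$ (ii) Let the sequences $(s_d,k_d, a_d)_{d\geq 1}$ be such that $d/s_d\to \infty$ and $$a_d^2 \geq \sigma^2\big(16\sqrt{k_d\log(d/s_d)} + 80 \log(d/s_d)\big).$$ Then each of the following two selectors $\hat\eta$: the thresholding selector $\hat\eta_j=\mathbf{1}(X_j\ge t_d)$, $j=1,\dots,d$, with $t_d= \sigma^2(k_d + 4 \log(d/s_d) + 4 \sqrt{k_d\log(d/s_d)})$, and the scan selector $\hat\eta =\hat{\eta}^{(s_d)}_*$, satisfies $$\limsup_{d \to \infty} \sup_{\theta \in \Theta_{k_d,d} (s_d,a_d)} \frac{1}{s_d} \mathbf{E}_\theta |\hat \eta - \eta(\theta)|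 =0.$$
   Context: Gaussian matrix model: one observes $Y_{ij}=\theta_{ij}+\sigma\xi_{ij}$, $i=1,\dots,k$, $j=1,\dots,d$, where $\xi_{ij}$ are i.i.d. standard normal and $\sigma>0$. $\theta_j,Y_j\in\mathbb{R}^k$ denote the $j$th columns of $\theta=(\theta_{ij})$ and $(Y_{ij})$, and $\|\cdot\|$ is the Euclidean norm. For positive integers $s<d$, $k$ and $a>0$, $$\Theta_{k,d}(s,a)=\{\theta\in\mathbb{R}^{k\times d}:\ \exists S\subset\{1,\dots,d\},\ |S|=s,\ \|\theta_j\|\ge a\ \text{for } j\in S,\ \theta_j=0\ \text{for } j\notin S\}.$$ $\eta(\theta)\in\{0,1\}^d$ has components $\eta_j(\theta)=\mathbf{1}(\theta_j\ne0)$. $\mathbf{P}_\theta,\mathbf{E}_\theta$ are the probability and expectation for the observations $(Y_{ij})$ (with $k=k_d$). $|\hat\eta-\eta|=\sum_{j=1}^d\mathbf{1}(\hat\eta_j\neq\eta_j)$; $S_\eta=\{j:\eta_j\neq0\}$. Set $X_j=\|Y_j\|^2$, $j=1,\dots,d$, let $X_{(1)}\ge\dots\ge X_{(d)}$ be the ordered values and $\mathbb{X}_{1:s}=\{X_{(1)},\dots,X_{(s)}\}$. The scan selector is $\hat\eta^{(s)}_*=(\mathbf{1}(X_1\in\mathbb{X}_{1:s}),\dots,\mathbf{1}(X_d\in\mathbb{X}_{1:s}))$. Here $s_d,k_d$ are positive integers with $s_d<d$, and $a_d>0$; $k_d$ may vary arbitrarily with $d$. *)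

theory Defs
  imports "HOL-Probability.Probability"
begin

text \<open>
  A real \<open>k \<times> d\<close> matrix is a function on index pairs \<open>(i, j)\<close> that is \<open>undefined\<close> outside
  \<open>{1..k} \<times> {1..d}\<close>, so that \<open>real_matrices k d\<close> is the underlying set of the product
  \<open>\<sigma>\<close>-algebra \<open>PiM (entries k d) (\<lambda>_. borel)\<close>. Vectors in \<open>{0,1}\<^sup>d\<close> are functions \<open>nat \<Rightarrow> nat\<close>
  of which only the arguments in \<open>{1..d}\<close> matter.
\<close>

type_synonym matr = "nat \<times> nat \<Rightarrow> real"

definition entries :: "nat \<Rightarrow> nat \<Rightarrow> (nat \<times> nat) set" where
  "entries k d = {1..k} \<times> {1..d}"

definition real_matrices :: "nat \<Rightarrow> nat \<Rightarrow> matr set" where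
  "real_matrices k d = entries k d \<rightarrow>\<^sub>E UNIV"

definition col_zero :: "nat \<Rightarrow> matr \<Rightarrow> nat \<Rightarrow> bool" where
  "col_zero k \<theta> j \<longleftrightarrow> (\<forall>i\<in>{1..k}. \<theta> (i, j) = 0)"

definition col_norm :: "nat \<Rightarrow> matr \<Rightarrow> nat \<Rightarrow> real" where
  "col_norm k \<theta> j = L2_set (\<lambda>i. \<theta> (i, j)) {1..k}"

definition Theta :: "nat \<Rightarrow> nat \<Rightarrow> nat \<Rightarrow> real \<Rightarrow> matr set" where
  "Theta k d s a = {\<theta> \<in> real_matrices k d. \<exists>S\<subseteq>{1..d}. card S = s \<and>
     (\<forall>j\<in>S. col_norm k \<theta> j \<ge> a) \<and> (\<forall>j\<in>{1..d} - S. col_zero k \<theta> j)}"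

definition eta :: "nat \<Rightarrow> matr \<Rightarrow> nat \<Rightarrow> nat" where
  "eta k \<theta> j = of_bool (\<not> col_zero k \<theta> j)"

definition support :: "nat \<Rightarrow> (nat \<Rightarrow> nat) \<Rightarrow> nat set" where
  "support d h = {j\<in>{1..d}. h j \<noteq> 0}"

definition hamming :: "nat \<Rightarrow> (nat \<Rightarrow> nat) \<Rightarrow> (nat \<Rightarrow> nat) \<Rightarrow> real" where
  "hamming d h h' = (\<Sum>j=1..d. of_bool (h j \<noteq> h' j))"

definition noise :: "nat \<Rightarrow> nat \<Rightarrow> matr measure" where
  "noise k d = PiM (entries k d) (\<lambda>_. std_normal_distribution)"

text \<open>The law of the observations \<open>Y = \<theta> + \<sigma> \<xi>\<close>, where \<open>\<xi>\<close> has independent standard normal entries.\<close>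

definition obs_law :: "real \<Rightarrow> nat \<Rightarrow> nat \<Rightarrow> matr \<Rightarrow> matr measure" where
  "obs_law \<sigma> k d \<theta> = distr (noise k d) (PiM (entries k d) (\<lambda>_. borel))
     (\<lambda>\<xi>. \<lambda>p\<in>entries k d. \<theta> p + \<sigma> * \<xi> p)"

definition prob_obs :: "real \<Rightarrow> nat \<Rightarrow> nat \<Rightarrow> matr \<Rightarrow> (matr \<Rightarrow> bool) \<Rightarrow> real" where
  "prob_obs \<sigma> k d \<theta> Q = measure (obs_law \<sigma> k d \<theta>) {Y \<in> space (obs_law \<sigma> k d \<theta>). Q Y}"

definition expect_obs :: "real \<Rightarrow> nat \<Rightarrow> nat \<Rightarrow> matr \<Rightarrow> (matr \<Rightarrow> real) \<Rightarrow> real" where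
  "expect_obs \<sigma> k d \<theta> f = (\<integral>Y. f Y \<partial>obs_law \<sigma> k d \<theta>)"

definition col_energy :: "nat \<Rightarrow> matr \<Rightarrow> nat \<Rightarrow> real" where
  "col_energy k Y j = (col_norm k Y j)\<^sup>2"

text \<open>\<open>order_stat d X m\<close> is the \<open>m\<close>-th largest (counting from 1, with multiplicity) of
  \<open>X 1, \<dots>, X d\<close>, meaningful for \<open>1 \<le> m \<le> d\<close>.\<close>

definition order_stat :: "nat \<Rightarrow> (nat \<Rightarrow> real) \<Rightarrow> nat \<Rightarrow> real" where
  "order_stat d X m = rev (sort (map X [1..<Suc d])) ! (m - 1)"

definition threshold_selector :: "nat \<Rightarrow> real \<Rightarrow> matr \<Rightarrow> nat \<Rightarrow> nat" where
  "threshold_selector k t Y j = of_bool (col_energy k Y j \<ge> t)"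

definition scan_selector :: "nat \<Rightarrow> nat \<Rightarrow> nat \<Rightarrow> matr \<Rightarrow> nat \<Rightarrow> nat" where
  "scan_selector k d s Y j =
     of_bool (col_energy k Y j \<in> order_stat d (col_energy k Y) ` {1..s})"

end

theory Submission imports Defs begin

text \<open>For \<open>u > - 1/2\<close> completing the square gives \<open>E exp (- u (v + \<xi>)\<^sup>2)\<close> for standard normal
  \<open>\<xi>\<close>, hence the Laplace transform of a column energy. Put \<open>y = \<surd>L\<close> and \<open>q = \<surd>k\<close>, where \<open>L\<close> is
  \<open>ln d\<close> or \<open>ln (d/s)\<close>; the threshold is \<open>\<sigma>\<^sup>2 (q + 2 y)\<^sup>2\<close>, and Chernoff's bound with parameter
  \<open>u = y / (q + 2 y)\<close> (for missed columns) or \<open>u = - y / (q + 2 y)\<close> (for false alarms) shows that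
  each column is misclassified with probability at most \<open>exp (- 2 L)\<close>. The loss of the scan selector
  is almost surely at most twice that of the thresholding selector, whatever the threshold.\<close>

section \<open>Exponential moments of a Gaussian quadratic\<close>

lemma std_normal_exp_quadratic:
  fixes u v :: real
  assumes "u > - 1/2"
  shows "has_bochner_integral std_normal_distribution (\<lambda>x. exp (- u * (v + x)\<^sup>2))
    (exp (- u * v\<^sup>2 / (1 + 2*u)) / sqrt (1 + 2*u))"
proof -
  define w where "w = 1 + 2*u"
  have w: "w > 0" and u: "u = (w - 1) / 2" using assms by (auto simp: w_def)
  \<comment> \<open>The tilted density is again Gaussian, with mean \<open>- 2 * u * v / w\<close>
    and variance \<open>1 / w\<close>, where \<open>w > 0\<close> because \<open>u > - 1/2\<close>.
    Only its normalising constant remains after integration.\<close>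
  have *: "std_normal_density x * exp (- u * (v + x)\<^sup>2) =
      normal_density (- 2 * u * v / w) (1/sqrt w) x * (exp (- u * v\<^sup>2 / w) / sqrt w)" for x
  proof -
    have e: "- x\<^sup>2/2 + (- u * (v + x)\<^sup>2) = - (x - (- 2 * u * v / w))\<^sup>2 / (2 * (1/sqrt w)\<^sup>2) + (- u * v\<^sup>2 / w)"
      using w unfolding u power_divide real_sqrt_pow2[OF less_imp_le[OF w]]
      by (simp add: field_simps power2_eq_square)
    have c: "sqrt (2 * pi * (1/sqrt w)\<^sup>2) = sqrt (2 * pi) / sqrt w"
      using w by (simp add: power_divide real_sqrt_divide)
    show ?thesis
      unfolding normal_density_def c using w e
      by (simp add: exp_add[symmetric])
  qed
  have 1: "has_bochner_integral lborel (\<lambda>x. std_normal_density x * exp (- u * (v + x)\<^sup>2))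
     (1 * (exp (- u * v\<^sup>2 / w) / sqrt w))"
    unfolding * using w by (intro has_bochner_integral_mult_left) (simp add: has_bochner_integral_iff)
  show ?thesis
    by (rule has_bochner_integral_density) (use 1 in \<open>simp_all flip: w_def\<close>)
qed

section \<open>The observation law and the Laplace transform of a column energy\<close>

lemma finite_entries [simp]: "finite (entries k d)"
  by (simp add: entries_def)

lemma product_prob_space_std_normal: "product_prob_space (\<lambda>_. std_normal_distribution)"
  by (intro product_prob_spaceI prob_space_normal_density) simp

lemma prob_space_noise: "prob_space (noise k d)"
  unfolding noise_def by (intro prob_space_PiM prob_space_normal_density) simp

lemma measurable_obs:
  "(\<lambda>\<xi>. \<lambda>p\<in>entries k d. \<theta> p + \<sigma> * \<xi> p) \<in> noise k d \<rightarrow>\<^sub>M PiM (entries k d) (\<lambda>_. borel)"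
  unfolding noise_def by measurable

lemma prob_space_obs_law: "prob_space (obs_law \<sigma> k d \<theta>)"
  unfolding obs_law_def by (rule prob_space.prob_space_distr[OF prob_space_noise measurable_obs])

lemma col_energy_sum: "col_energy k Y j = (\<Sum>i=1..k. (Y (i, j))\<^sup>2)"
  by (simp add: col_energy_def col_norm_def L2_set_def sum_nonneg)

lemma measurable_col_energy:
  "j \<in> {1..d} \<Longrightarrow> (\<lambda>Y. col_energy k Y j) \<in> borel_measurable (PiM (entries k d) (\<lambda>_. borel))"
  unfolding col_energy_sum
  by (intro borel_measurable_sum borel_measurable_power measurable_component_singleton)
     (auto simp: entries_def)

lemma col_energy_obs:
  assumes "j \<in> {1..d}"
  shows "col_energy k (\<lambda>p\<in>entries k d. \<theta> p + \<sigma> * \<xi> p) j = (\<Sum>i=1..k. (\<theta> (i, j) + \<sigma> * \<xi> (i, j))\<^sup>2)"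
  unfolding col_energy_sum using assms by (intro sum.cong) (auto simp: entries_def)

text \<open>Independence of the noise entries turns the integral into a product: the
  \<open>k\<close> entries of column \<open>j\<close> contribute one Gaussian factor each, all other
  entries contribute 1. The value is the Laplace transform of a noncentral chi-square law with
  \<open>k\<close> degrees of freedom.\<close>

lemma exp_col_energy_obs:
  assumes "\<sigma> > 0" and "u > - 1/2" and j: "j \<in> {1..d}"
  shows "has_bochner_integral (obs_law \<sigma> k d \<theta>) (\<lambda>Y. exp (- u * (col_energy k Y j / \<sigma>\<^sup>2)))
    ((1 / sqrt (1 + 2*u)) ^ k * exp (- u * (col_energy k \<theta> j / \<sigma>\<^sup>2) / (1 + 2*u)))"
proof -
  interpret product_prob_space "\<lambda>_::nat\<times>nat. std_normal_distribution"
    by (rule product_prob_space_std_normal)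
  define f :: "nat \<times> nat \<Rightarrow> real \<Rightarrow> real" where
    "f p x = (if snd p = j then exp (- u * (\<theta> p / \<sigma> + x)\<^sup>2) else 1)" for p x
  have prob: "measure std_normal_distribution UNIV = 1"
    using M.prob_space by simp
  have f: "integrable std_normal_distribution (f p)"
      "(\<integral>x. f p x \<partial>std_normal_distribution) =
        (if snd p = j then exp (- u * (\<theta> p / \<sigma>)\<^sup>2 / (1 + 2*u)) / sqrt (1 + 2*u) else 1)" for p
    using std_normal_exp_quadratic[OF assms(2), of "\<theta> p / \<sigma>"]
    by (cases "snd p = j"; simp add: f_def[abs_def] has_bochner_integral_iff prob)+
  have col: "(\<Prod>p\<in>entries k d. if snd p = j then g p else 1) = (\<Prod>i=1..k. g (i, j))"
    for g :: "nat \<times> nat \<Rightarrow> real"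
  proof -
    have "(\<Prod>p\<in>entries k d. if snd p = j then g p else 1) = (\<Prod>p\<in>{1..k} \<times> {j}. g p)"
      using j by (intro prod.mono_neutral_cong_right) (auto simp: entries_def)
    also have "\<dots> = (\<Prod>i=1..k. g (i, j))"
      by (simp add: prod.cartesian_product')
    finally show ?thesis .
  qed
  have eq: "(\<Prod>p\<in>entries k d. f p (\<xi> p)) =
      exp (- u * (col_energy k (\<lambda>p\<in>entries k d. \<theta> p + \<sigma> * \<xi> p) j / \<sigma>\<^sup>2))" for \<xi>
  proof -
    have "(\<Prod>p\<in>entries k d. f p (\<xi> p)) = (\<Prod>i=1..k. exp (- u * (\<theta> (i,j) / \<sigma> + \<xi> (i,j))\<^sup>2))"
      unfolding f_def by (rule col)
    also have "\<dots> = exp (- u * (\<Sum>i=1..k. (\<theta> (i,j) / \<sigma> + \<xi> (i,j))\<^sup>2))"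
      by (simp add: exp_sum sum_distrib_left)
    also have "(\<Sum>i=1..k. (\<theta> (i,j) / \<sigma> + \<xi> (i,j))\<^sup>2) = (\<Sum>i=1..k. (\<theta> (i,j) + \<sigma> * \<xi> (i,j))\<^sup>2) / \<sigma>\<^sup>2"
      unfolding sum_divide_distrib
    proof (intro sum.cong refl)
      fix i
      have "\<theta> (i,j) / \<sigma> + \<xi> (i,j) = (\<theta> (i,j) + \<sigma> * \<xi> (i,j)) / \<sigma>"
        using assms(1) by (simp add: field_simps)
      then show "(\<theta> (i,j) / \<sigma> + \<xi> (i,j))\<^sup>2 = (\<theta> (i,j) + \<sigma> * \<xi> (i,j))\<^sup>2 / \<sigma>\<^sup>2"
        by (simp add: power_divide)
    qed
    finally show ?thesis by (simp add: col_energy_obs[OF j])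
  qed
  have int: "integral\<^sup>L (noise k d) (\<lambda>\<xi>. \<Prod>p\<in>entries k d. f p (\<xi> p)) =
      (1 / sqrt (1 + 2*u)) ^ k * exp (- u * (col_energy k \<theta> j / \<sigma>\<^sup>2) / (1 + 2*u))"
    unfolding noise_def
    by (simp add: product_integral_prod f col col_energy_sum prod_dividef power_one_over
        exp_sum[symmetric] sum_divide_distrib sum_distrib_left power_divide)
  have "has_bochner_integral (noise k d) (\<lambda>\<xi>. \<Prod>p\<in>entries k d. f p (\<xi> p))
      ((1 / sqrt (1 + 2*u)) ^ k * exp (- u * (col_energy k \<theta> j / \<sigma>\<^sup>2) / (1 + 2*u)))"
    using int product_integrable_prod[of "entries k d" f] f
    by (auto simp: has_bochner_integral_iff noise_def)
  then show ?thesis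
    unfolding eq obs_law_def using measurable_obs measurable_col_energy[OF j]
    by (intro has_bochner_integral_distr) auto
qed

section \<open>Chernoff bounds for false alarms and missed columns\<close>

text \<open>Here \<open>1 / (1 - 2*w)\<close> equals \<open>1 + 2*y/q\<close>, which is at most
  \<open>exp (2*y/q)\<close>, so the \<open>k\<close>-th power contributes at most
  \<open>exp (q * y)\<close>. This cancels the \<open>q * y\<close> in
  \<open>w * (q + 2*y)\<^sup>2 = q * y + 2 * y\<^sup>2\<close>.\<close>

lemma chernoff_upper:
  fixes y q :: real
  assumes "y \<ge> 0" "q > 0" "real k = q\<^sup>2"
  defines "w \<equiv> y / (q + 2*y)"
  shows "exp (- w * (q + 2*y)\<^sup>2) * (1 / sqrt (1 - 2*w)) ^ k \<le> exp (- 2 * y\<^sup>2)"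
proof -
  have "1 - 2*w = q / (q + 2*y)" using assms by (simp add: w_def field_simps)
  then have "1 / sqrt (1 - 2*w) = sqrt (1 + 2*y/q)"
    using assms by (simp add: real_sqrt_divide[symmetric] add_divide_distrib flip: real_sqrt_inverse inverse_eq_divide)
  also have "\<dots> \<le> sqrt (exp (2*(y/q)))"
    using exp_ge_add_one_self[of "2*y/q"] by simp
  also have "\<dots> = exp (y/q)" by (subst exp_double) simp
  finally have "(1 / sqrt (1 - 2*w)) ^ k \<le> exp (y/q) ^ k"
    using assms by (intro power_mono) (auto simp: w_def field_simps)
  also have "\<dots> = exp (q * y)"
    using assms by (simp add: exp_of_nat_mult[symmetric] power2_eq_square)
  finally have "exp (- w * (q + 2*y)\<^sup>2) * (1 / sqrt (1 - 2*w)) ^ k \<le> exp (- w * (q + 2*y)\<^sup>2) * exp (q * y)"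
    by simp
  also have "w * (q + 2*y)\<^sup>2 = y * (q + 2*y)"
    using assms by (simp add: w_def power2_eq_square)
  then have "exp (- w * (q + 2*y)\<^sup>2) * exp (q * y) = exp (- 2 * y\<^sup>2)"
    by (simp add: exp_add[symmetric] algebra_simps power2_eq_square)
  finally show ?thesis .
qed

text \<open>With \<open>r = q + 4*y\<close> one has \<open>1 / (1 + 2*w) = 1 - 2*y/r\<close>, at
  most \<open>exp (- 2*y/r)\<close>. Comparing exponents and multiplying by \<open>r\<close> leaves
  \<open>y * (q + 4*y)\<^sup>2 \<le> q\<^sup>2 * y + y * \<mu>\<close>, that is,
  \<open>8 * q * y\<^sup>2 + 16 * y ^ 3 \<le> y * \<mu>\<close>.\<close>

lemma chernoff_lower:
  fixes y q \<mu> :: real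
  assumes "y \<ge> 0" "q > 0" "real k = q\<^sup>2" and \<mu>: "\<mu> \<ge> 16 * q * y + 80 * y\<^sup>2"
  defines "w \<equiv> y / (q + 2*y)"
  shows "exp (w * (q + 2*y)\<^sup>2) * ((1 / sqrt (1 + 2*w)) ^ k * exp (- w * \<mu> / (1 + 2*w))) \<le> exp (- 2 * y\<^sup>2)"
proof -
  define r where "r = q + 4*y"
  have r: "r > 0" using assms by (simp add: r_def)
  have w: "1 + 2*w = r / (q + 2*y)" using assms by (simp add: w_def r_def field_simps)
  have "1 / sqrt (1 + 2*w) = sqrt (1 + - 2*y/r)"
    unfolding w using assms r by (simp add: real_sqrt_divide[symmetric] field_simps flip: real_sqrt_inverse inverse_eq_divide)
      (simp add: r_def)
  also have "\<dots> \<le> sqrt (exp (2*(- y/r)))"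
    using exp_ge_add_one_self[of "2*(- y/r)"] by simp
  also have "\<dots> = exp (- y/r)" by (subst exp_double) simp
  finally have "(1 / sqrt (1 + 2*w)) ^ k \<le> exp (- y/r) ^ k"
    using assms by (intro power_mono) (auto simp: w_def field_simps)
  also have "\<dots> = exp (- q\<^sup>2 * y / r)"
    using assms by (simp add: exp_of_nat_mult[symmetric])
  finally have "exp (w * (q + 2*y)\<^sup>2) * ((1 / sqrt (1 + 2*w)) ^ k * exp (- w * \<mu> / (1 + 2*w)))
     \<le> exp (w * (q + 2*y)\<^sup>2) * (exp (- q\<^sup>2 * y / r) * exp (- w * \<mu> / (1 + 2*w)))"
    by simp
  also have "\<dots> = exp (y * (q + 2*y) - q\<^sup>2 * y / r - y * \<mu> / r)"
  proof -
    have "w * (q + 2*y)\<^sup>2 = y * (q + 2*y)" "w * \<mu> / (1 + 2*w) = y * \<mu> / r"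
      unfolding w using assms by (simp_all add: w_def power2_eq_square)
    then show ?thesis by (simp add: exp_add[symmetric])
  qed
  also have "\<dots> \<le> exp (- 2 * y\<^sup>2)"
  proof -
    have "y * \<mu> \<ge> y * (16 * q * y + 80 * y\<^sup>2)"
      using assms by (intro mult_left_mono) auto
    \<comment> \<open>The right-hand side is the gap between the assumed lower bound for
      \<open>y * \<mu>\<close> and the amount required.\<close>
    moreover have "0 \<le> 8 * (q * y * y) + 64 * (y * y * y)" using assms by simp
    ultimately have "(y * (q + 2*y) + 2 * y\<^sup>2) * r \<le> q\<^sup>2 * y + y * \<mu>"
      by (simp add: r_def algebra_simps power2_eq_square)
    then have "y * (q + 2*y) + 2 * y\<^sup>2 \<le> (q\<^sup>2 * y + y * \<mu>) / r"
      using r by (simp add: pos_le_divide_eq)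
    then show ?thesis by (simp add: add_divide_distrib)
  qed
  finally show ?thesis .
qed

section \<open>Almost sure absence of ties\<close>

lemma AE_col_energy_neq:
  assumes "\<sigma> > 0" "1 \<le> k" and i: "i \<in> {1..d}" and j: "j \<in> {1..d}" and "i \<noteq> j"
  shows "AE Y in obs_law \<sigma> k d \<theta>. col_energy k Y i \<noteq> col_energy k Y j"
proof -
  interpret product_prob_space "\<lambda>_::nat\<times>nat. std_normal_distribution"
    by (rule product_prob_space_std_normal)
  define E where "E j \<xi> = (\<Sum>a=1..k. (\<theta> (a, j) + \<sigma> * \<xi> (a, j))\<^sup>2)" for j \<xi>
  define p where "p = (1::nat, i)"
  define I where "I = entries k d - {p}"
  have I: "entries k d = insert p I" "finite I" "p \<notin> I"
    using assms by (auto simp: I_def p_def entries_def)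
  have E[measurable]: "(\<lambda>\<xi>. E j \<xi>) \<in> borel_measurable (noise k d)" if "j \<in> {1..d}" for j
    using measurable_compose[OF measurable_obs measurable_col_energy[OF that]] 
    by (simp add: col_energy_obs[OF that] E_def)
  define N where "N = {\<xi> \<in> space (noise k d). E i \<xi> = E j \<xi>}"
  have N: "N \<in> sets (noise k d)"
    unfolding N_def using i j by measurable
  have null: "(\<integral>\<^sup>+y. indicator N (\<xi>(p := y)) \<partial>std_normal_distribution) = 0" for \<xi>
  proof -
    \<comment> \<open>In terms of the free entry \<open>y\<close>, a tie means
      \<open>(\<theta> p + \<sigma> * y)\<^sup>2 = c\<close>.\<close>
    define c where "c = E j \<xi> - (\<Sum>a=2..k. (\<theta> (a, i) + \<sigma> * \<xi> (a, i))\<^sup>2)"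
    have "AE y in std_normal_distribution. y \<noteq> b" for b :: real
    proof -
      have "AE y in lborel. y \<noteq> b" by (rule AE_lborel_singleton)
      then show ?thesis by (subst AE_density) (auto elim: eventually_mono)
    qed
    from this[of "(sqrt c - \<theta> p) / \<sigma>"] this[of "(- sqrt c - \<theta> p) / \<sigma>"]
    have "AE y in std_normal_distribution. indicator N (\<xi>(p := y)) = (0::ennreal)"
    proof eventually_elim
      case (elim y)
      have "{1..k} = insert 1 {2..k}" using assms by auto
      then have 1: "E i (\<xi>(p := y)) = (\<theta> p + \<sigma> * y)\<^sup>2 + (\<Sum>a=2..k. (\<theta> (a, i) + \<sigma> * \<xi> (a, i))\<^sup>2)"
        by (auto simp: E_def p_def intro!: sum.cong)
      have 2: "E j (\<xi>(p := y)) = E j \<xi>"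
        using assms by (auto simp: E_def p_def)
      have "\<theta> p + \<sigma> * y \<noteq> sqrt c" "\<theta> p + \<sigma> * y \<noteq> - sqrt c"
        using elim assms by (auto simp: field_simps)
      \<comment> \<open>The sign of \<open>c\<close> need not be discussed: if the square equals
        \<open>c\<close>, then \<open>sqrt c\<close> is the absolute value of its base.\<close>
      then have "(\<theta> p + \<sigma> * y)\<^sup>2 \<noteq> c"
        by (metis abs_real_def minus_equation_iff real_sqrt_abs)
      then have "\<xi>(p := y) \<notin> N"
        by (auto simp: N_def 1 2 c_def)
      then show ?case by simp
    qed
    then have "(\<integral>\<^sup>+y. indicator N (\<xi>(p := y)) \<partial>std_normal_distribution) = (\<integral>\<^sup>+y. 0 \<partial>std_normal_distribution)"
      by (rule nn_integral_cong_AE)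
    then show ?thesis by simp
  qed
  have "emeasure (noise k d) N = (\<integral>\<^sup>+\<xi>. indicator N \<xi> \<partial>noise k d)"
    using N by simp
  also have "\<dots> = 0"
    using N unfolding noise_def I(1)
    by (subst product_nn_integral_insert[OF I(2,3)]) (simp_all add: null)
  finally have "AE \<xi> in noise k d. E i \<xi> \<noteq> E j \<xi>"
    using N by (intro AE_I[of _ _ N]) (auto simp: N_def)
  moreover have "{Y \<in> space (PiM (entries k d) (\<lambda>_. borel)). col_energy k Y i \<noteq> col_energy k Y j}
      \<in> sets (PiM (entries k d) (\<lambda>_. borel))"
    by (intro borel_measurable_neq measurable_col_energy i j)
  ultimately show ?thesis
    unfolding obs_law_def
    by (subst AE_distr_iff[OF measurable_obs]) (auto simp: col_energy_obs[OF i] col_energy_obs[OF j] E_def)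
qed

section \<open>Hamming loss, order statistics and the scan selector\<close>

lemma hamming_nonneg: "hamming d h h' \<ge> 0"
  by (simp add: hamming_def sum_nonneg)

lemma hamming_card: "hamming d h h' = card {j\<in>{1..d}. h j \<noteq> h' j}"
  by (simp add: hamming_def Int_def conj_commute)

text \<open>Without ties the decreasing list of values has no repetition, so its first
  \<open>s\<close> entries correspond to exactly \<open>s\<close> indices. Both facts can fail to be
  about \<open>s\<close> columns when values coincide, since the selector tests membership of
  values.\<close>

lemma order_stat_top:
  assumes inj: "inj_on X {1..d}" and "s \<le> d"
  defines "R \<equiv> {j\<in>{1..d}. X j \<in> order_stat d X ` {1..s}}"
  shows "card R = s" and "\<And>i j. i \<in> R \<Longrightarrow> j \<in> {1..d} - R \<Longrightarrow> X j \<le> X i"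
proof -
  define ys where "ys = rev (sort (map X [1..<Suc d]))"
  have ys: "length ys = d" "set ys = X ` {1..d}" "distinct ys" "sorted (rev ys)"
    using inj by (simp_all add: ys_def distinct_map atLeastLessThanSuc_atLeastAtMost del: upt_Suc)
  have "order_stat d X ` {1..s} = (\<lambda>m. ys ! m) ` ((\<lambda>m. m - 1) ` {1..s})"
    by (simp add: order_stat_def ys_def image_image)
  \<comment> \<open>Order statistics are counted from 1, list positions from 0.\<close>
  also have "(\<lambda>m. m - 1) ` {1..s} = {..<s}"
    by (force simp: image_iff intro: bexI[of _ "Suc _"])
  finally have os: "order_stat d X ` {1..s} = (\<lambda>m. ys ! m) ` {..<s}" .
  have top: "(\<lambda>m. ys ! m) ` {..<s} \<subseteq> X ` {1..d}" "card ((\<lambda>m. ys ! m) ` {..<s}) = s"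
    using \<open>s \<le> d\<close> ys by (auto simp flip: ys(2) simp: card_image inj_on_nth)
  have "X ` {j\<in>D. X j \<in> T} = T" if "T \<subseteq> X ` D" for D T
    using that by blast
  from this[OF top(1)] have "X ` R = (\<lambda>m. ys ! m) ` {..<s}"
    unfolding R_def os .
  moreover have "inj_on X R" by (rule inj_on_subset[OF inj]) (auto simp: R_def)
  ultimately show "card R = s" using top(2) card_image[of X R] by simp
  fix i j assume i: "i \<in> R" and j: "j \<in> {1..d} - R"
  from i obtain m where m: "m < s" "X i = ys ! m" unfolding R_def os by auto
  from j have "X j \<in> set ys" by (simp add: ys)
  then obtain n where n: "n < d" "X j = ys ! n" unfolding in_set_conv_nth ys(1) by auto
  have "X j \<notin> (\<lambda>m. ys ! m) ` {..<s}" using j unfolding R_def os by auto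
  then have "\<not> n < s" using n by auto
  then have "m \<le> n" using m by simp
  then show "X j \<le> X i"
    using sorted_rev_nth_mono[OF ys(4), of m n] n ys(1) m by simp
qed

text \<open>Without ties the selector picks exactly \<open>s\<close> columns, so it makes as many false positives as
  false negatives; and either all selected energies reach \<open>t\<close>, or all rejected ones are below \<open>t\<close>.\<close>

lemma hamming_scan_le_threshold:
  assumes inj: "inj_on (col_energy k Y) {1..d}" and "s \<le> d" and s: "card (support d h) = s"
    and h: "\<And>j. h j \<in> {0, 1}"
  shows "hamming d (scan_selector k d s Y) h \<le> 2 * hamming d (threshold_selector k t Y) h"
proof -
  define X where "X = col_energy k Y"
  define S where "S = support d h"
  define R where "R = {j\<in>{1..d}. X j \<in> order_stat d X ` {1..s}}"
  have fin: "finite R" "finite S" by (auto simp: R_def S_def support_def)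
  have R: "card R = s" "\<And>i j. i \<in> R \<Longrightarrow> j \<in> {1..d} - R \<Longrightarrow> X j \<le> X i"
    using order_stat_top[OF inj \<open>s \<le> d\<close>] by (auto simp: R_def X_def)
  have hS: "h j = of_bool (j \<in> S)" if "j \<in> {1..d}" for j
    using h[of j] that by (auto simp: S_def support_def)
  have S: "S \<subseteq> {1..d}" by (auto simp: S_def support_def)
  have "R \<subseteq> {1..d}" by (auto simp: R_def)
  define T where "T = {j\<in>{1..d}. (t \<le> X j) \<noteq> (j \<in> S)}"
  have finT: "finite T" by (simp add: T_def)
  have "{j\<in>{1..d}. scan_selector k d s Y j \<noteq> h j} = {j\<in>{1..d}. j \<in> R \<longleftrightarrow> j \<notin> S}"
  proof (intro Collect_cong conj_cong refl)
    fix j assume j: "j \<in> {1..d}"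
    then have "scan_selector k d s Y j = of_bool (j \<in> R)"
      unfolding scan_selector_def R_def X_def by simp
    then show "scan_selector k d s Y j \<noteq> h j \<longleftrightarrow> (j \<in> R \<longleftrightarrow> j \<notin> S)"
      using hS[OF j] by simp
  qed
  also have "\<dots> = (R - S) \<union> (S - R)"
    using S \<open>R \<subseteq> {1..d}\<close> by blast
  finally have "{j\<in>{1..d}. scan_selector k d s Y j \<noteq> h j} = (R - S) \<union> (S - R)" .
  then have scan: "hamming d (scan_selector k d s Y) h = card (R - S) + card (S - R)"
    using fin by (simp add: hamming_card card_Un_disjoint Int_Diff Diff_Int_distrib2)
  have "{j\<in>{1..d}. threshold_selector k t Y j \<noteq> h j} = T"
    unfolding T_def
  proof (intro Collect_cong conj_cong refl)
    fix j assume "j \<in> {1..d}"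
    then show "threshold_selector k t Y j \<noteq> h j \<longleftrightarrow> (t \<le> X j) \<noteq> (j \<in> S)"
      using hS[of j] by (simp add: threshold_selector_def X_def)
  qed
  then have thr: "hamming d (threshold_selector k t Y) h = card T"
    by (simp add: hamming_card)
  have "card (R - S) = card (S - R)"
    using R(1) s fin by (simp add: card_Diff_subset_Int Int_commute flip: S_def)
  \<comment> \<open>Either the false alarms of the scan are also false alarms of thresholding, or
    its misses are also misses of thresholding.\<close>
  moreover have "card (R - S) \<le> card T \<or> card (S - R) \<le> card T"
  proof (cases "\<forall>i\<in>R. t \<le> X i")
    case True
    then have "R - S \<subseteq> T" by (auto simp: T_def R_def)
    then show ?thesis using finT by (auto intro: card_mono)
  next
    case False
    then obtain i where "i \<in> R" "X i < t" by auto
    then have "S - R \<subseteq> T"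
      using R(2)[of i] by (force simp: T_def S_def support_def)
    then show ?thesis using finT by (auto intro: card_mono)
  qed
  ultimately show ?thesis unfolding scan thr by linarith
qed

text \<open>Lets Markov's inequality turn a bound on the expected loss into one on the probability
  of a wrong support.\<close>

lemma one_le_hamming:
  assumes "support d h \<noteq> support d h'"
  shows "1 \<le> hamming d h h'"
proof -
  from assms have "{j\<in>{1..d}. h j \<noteq> h' j} \<noteq> {}" by (auto simp: support_def)
  then have "card {j\<in>{1..d}. h j \<noteq> h' j} > 0" by (subst card_gt_0_iff) simp
  then show ?thesis by (simp add: hamming_card)
qed

section \<open>The parameter space\<close>

text \<open>Since \<open>a > 0\<close>, columns of norm at least \<open>a\<close> are nonzero, so
  the set \<open>S\<close> in the definition of \<open>Theta\<close> can only be the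
  support.\<close>

lemma Theta_support:
  assumes "\<theta> \<in> Theta k d s a" "a > 0"
  shows "card (support d (eta k \<theta>)) = s"
    and "j \<in> support d (eta k \<theta>) \<Longrightarrow> col_norm k \<theta> j \<ge> a"
proof -
  from assms obtain S where S: "S \<subseteq> {1..d}" "card S = s"
    "\<And>j. j \<in> S \<Longrightarrow> col_norm k \<theta> j \<ge> a" "\<And>j. j \<in> {1..d} - S \<Longrightarrow> col_zero k \<theta> j"
    by (auto simp: Theta_def)
  have "\<not> col_zero k \<theta> j" if "j \<in> S" for j
  proof
    assume "col_zero k \<theta> j"
    then have "col_norm k \<theta> j = 0" by (simp add: col_zero_def col_norm_def L2_set_def)
    then show False using S(3)[OF that] \<open>a > 0\<close> by simp
  qed
  then have "support d (eta k \<theta>) = S"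
    using S by (auto simp: support_def eta_def)
  then show "card (support d (eta k \<theta>)) = s" "j \<in> support d (eta k \<theta>) \<Longrightarrow> col_norm k \<theta> j \<ge> a"
    using S by auto
qed

text \<open>Needed because the supremum over an empty set is \<open>-\<infinity>\<close> in \<open>ereal\<close>.\<close>

lemma Theta_nonempty:
  assumes "1 \<le> k" "s \<le> d" "a > 0"
  shows "Theta k d s a \<noteq> {}"
proof -
  define \<theta> :: matr where "\<theta> = (\<lambda>p\<in>entries k d. if fst p = 1 \<and> snd p \<in> {1..s} then a else 0)"
  have "col_norm k \<theta> j \<ge> a" if "j \<in> {1..s}" for j
  proof -
    have "a = \<bar>\<theta> (1, j)\<bar>" using that assms by (simp add: \<theta>_def entries_def)
    also have "\<dots> \<le> L2_set (\<lambda>i. \<bar>\<theta> (i, j)\<bar>) {1..k}"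
      using assms by (intro member_le_L2_set) auto
    also have "\<dots> = col_norm k \<theta> j"
      by (simp add: col_norm_def L2_set_def)
    finally show ?thesis .
  qed
  then have "\<theta> \<in> Theta k d s a"
    using assms unfolding Theta_def
    by (auto intro!: exI[of _ "{1..s}"] simp: real_matrices_def col_zero_def \<theta>_def entries_def)
  then show ?thesis by auto
qed

section \<open>Nonasymptotic risk bound for a fixed parameter\<close>

text \<open>\<open>L\<close> stays free so that \<open>ln d\<close> and \<open>ln (d/s)\<close> are
  both covered. Summing the bound \<open>exp (- 2 * L)\<close> over the \<open>d\<close> columns
  handles thresholding; the factor 2 pays for the scan selector.\<close>

lemma selector_risk:
  fixes L :: real
  assumes "\<sigma> > 0" "1 \<le> s" "s < d" "1 \<le> k" "a > 0" "L \<ge> 0"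
    and a: "a\<^sup>2 \<ge> \<sigma>\<^sup>2 * (16 * sqrt (real k * L) + 80 * L)"
    and \<theta>: "\<theta> \<in> Theta k d s a"
    and \<eta>: "\<eta> \<in> {threshold_selector k (\<sigma>\<^sup>2 * (real k + 4 * L + 4 * sqrt (real k * L))), scan_selector k d s}"
  shows "expect_obs \<sigma> k d \<theta> (\<lambda>Y. hamming d (\<eta> Y) (eta k \<theta>)) \<le> 2 * real d * exp (- 2 * L)"
    and "prob_obs \<sigma> k d \<theta> (\<lambda>Y. support d (\<eta> Y) \<noteq> support d (eta k \<theta>)) \<le> 2 * real d * exp (- 2 * L)"
proof -
  define M where "M = obs_law \<sigma> k d \<theta>"
  interpret M: prob_space M unfolding M_def by (rule prob_space_obs_law)
  define y where "y = sqrt L"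
  define q where "q = sqrt (real k)"
  have y: "y \<ge> 0" "y\<^sup>2 = L" and q: "q > 0" "real k = q\<^sup>2" and yq: "sqrt (real k * L) = q * y"
    using assms by (auto simp: y_def q_def real_sqrt_mult)
  define \<tau> where "\<tau> = (q + 2*y)\<^sup>2"
  define t where "t = \<sigma>\<^sup>2 * (real k + 4 * L + 4 * sqrt (real k * L))"
  have t: "t = \<sigma>\<^sup>2 * \<tau>"
    unfolding t_def \<tau>_def yq unfolding q(2) y(2)[symmetric] by (simp add: algebra_simps power2_eq_square)
  define S where "S = support d (eta k \<theta>)"
  have S: "card S = s" "\<And>j. j \<in> S \<Longrightarrow> col_norm k \<theta> j \<ge> a"
    using Theta_support[OF \<theta> \<open>a > 0\<close>] by (auto simp: S_def)
  define w where "w = y / (q + 2*y)"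
  \<comment> \<open>Strictness keeps both parameters \<open>w\<close> and \<open>- w\<close> above
    \<open>- 1/2\<close>, where the Laplace transform is available.\<close>
  have w: "0 \<le> w" "w < 1/2" using y q by (auto simp: w_def field_simps)
  \<comment> \<open>The sign is chosen so that the exponent
    \<open>v j * (\<tau> - col_energy k Y j / \<sigma>\<^sup>2)\<close> is nonnegative whenever
    thresholding errs at \<open>j\<close>: a support column is missed below \<open>\<tau>\<close>, a
    null column raises an alarm from \<open>\<tau>\<close> on.\<close>
  define v where "v j = (if j \<in> S then w else - w)" for j
  \<comment> \<open>Each term bounds the error indicator of column \<open>j\<close> pointwise, so the loss itself need not be
    known to be measurable.\<close>
  define G where "G Y = (\<Sum>j=1..d. exp (v j * \<tau>) * exp (- v j * (col_energy k Y j / \<sigma>\<^sup>2)))" for Y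
  define B where "B j = exp (v j * \<tau>) * ((1 / sqrt (1 + 2 * v j)) ^ k *
      exp (- v j * (col_energy k \<theta> j / \<sigma>\<^sup>2) / (1 + 2 * v j)))" for j
  have B: "B j \<le> exp (- 2 * L)" if j: "j \<in> {1..d}" for j
  proof (cases "j \<in> S")
    case True
    have "a\<^sup>2 \<le> col_energy k \<theta> j"
      unfolding col_energy_def using S(2)[OF True] \<open>a > 0\<close> by (intro power_mono) auto
    then have "\<sigma>\<^sup>2 * (16 * q * y + 80 * y\<^sup>2) \<le> col_energy k \<theta> j"
      using a by (simp add: yq y mult.assoc)
    then have "16 * q * y + 80 * y\<^sup>2 \<le> col_energy k \<theta> j / \<sigma>\<^sup>2"
      using \<open>\<sigma> > 0\<close> by (simp add: field_simps)
    from chernoff_lower[OF y(1) q this] True show ?thesis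
      by (simp add: B_def v_def \<tau>_def y flip: w_def)
  next
    case False
    then have "col_zero k \<theta> j" using j by (auto simp: S_def support_def eta_def)
    then have "col_energy k \<theta> j = 0" by (simp add: col_energy_sum col_zero_def)
    with chernoff_upper[OF y(1) q] False show ?thesis
      by (simp add: B_def v_def \<tau>_def y flip: w_def)
  qed
  have G: "has_bochner_integral M G (\<Sum>j=1..d. B j)"
    unfolding G_def B_def M_def
    by (intro has_bochner_integral_sum has_bochner_integral_mult_right exp_col_energy_obs)
       (use assms w in \<open>auto simp: v_def\<close>)
  have "(\<Sum>j=1..d. B j) \<le> of_nat (card {1..d}) * exp (- 2 * L)"
    using B by (intro sum_bounded_above) auto
  with G have 1: "integrable M (\<lambda>Y. 2 * G Y)" "(\<integral>Y. 2 * G Y \<partial>M) \<le> 2 * real d * exp (- 2 * L)"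
    by (auto simp: has_bochner_integral_iff)
  have G0: "G Y \<ge> 0" for Y by (simp add: G_def sum_nonneg)
  have thr: "hamming d (threshold_selector k t Y) (eta k \<theta>) \<le> G Y" for Y
    unfolding hamming_def G_def
  proof (intro sum_mono)
    fix j assume j: "j \<in> {1..d}"
    have "exp (v j * \<tau>) * exp (- v j * (col_energy k Y j / \<sigma>\<^sup>2)) \<ge> 1"
      if "threshold_selector k t Y j \<noteq> eta k \<theta> j"
    proof -
      have "j \<in> S \<longleftrightarrow> \<not> col_zero k \<theta> j"
        using j by (simp add: S_def support_def eta_def)
      with that have "t \<le> col_energy k Y j \<longleftrightarrow> j \<notin> S"
        by (simp add: threshold_selector_def eta_def of_bool_def split: if_splits)
      moreover have "t \<le> col_energy k Y j \<longleftrightarrow> \<tau> \<le> col_energy k Y j / \<sigma>\<^sup>2"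
        using \<open>\<sigma> > 0\<close> by (simp add: t field_simps)
      ultimately have "0 \<le> v j * (\<tau> - col_energy k Y j / \<sigma>\<^sup>2)"
        using mult_nonneg_nonneg[of w "\<tau> - col_energy k Y j / \<sigma>\<^sup>2"]
          mult_nonneg_nonneg[of w "col_energy k Y j / \<sigma>\<^sup>2 - \<tau>"] w(1)
        by (cases "j \<in> S") (simp_all add: v_def algebra_simps)
      then show ?thesis by (simp add: exp_add[symmetric] algebra_simps)
    qed
    then show "of_bool (threshold_selector k t Y j \<noteq> eta k \<theta> j)
        \<le> exp (v j * \<tau>) * exp (- v j * (col_energy k Y j / \<sigma>\<^sup>2))"
      by (auto simp: of_bool_def)
  qed
  have "AE Y in M. \<forall>i\<in>{1..d}. \<forall>j\<in>{1..d}. i \<noteq> j \<longrightarrow> col_energy k Y i \<noteq> col_energy k Y j"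
    unfolding M_def using AE_col_energy_neq[OF \<open>\<sigma> > 0\<close> \<open>1 \<le> k\<close>]
    by (intro AE_finite_allI finite_atLeastAtMost AE_impI)
  then have ham: "AE Y in M. hamming d (\<eta> Y) (eta k \<theta>) \<le> 2 * G Y"
  proof eventually_elim
    case (elim Y)
    then have "inj_on (col_energy k Y) {1..d}" by (auto simp: inj_on_def)
    from hamming_scan_le_threshold[OF this _ S(1)[unfolded S_def], of t] \<open>s < d\<close>
    have "hamming d (scan_selector k d s Y) (eta k \<theta>) \<le> 2 * hamming d (threshold_selector k t Y) (eta k \<theta>)"
      by (simp add: eta_def)
    then show ?case using \<eta> thr[of Y] G0[of Y] by (auto simp flip: t_def)
  qed
  \<comment> \<open>If the loss is not integrable, its integral is 0 by convention, still below the
    integral of the nonnegative \<open>2 * G\<close>.\<close>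
  have "expect_obs \<sigma> k d \<theta> (\<lambda>Y. hamming d (\<eta> Y) (eta k \<theta>)) \<le> (\<integral>Y. 2 * G Y \<partial>M)"
    unfolding expect_obs_def M_def[symmetric] using G0
    by (intro integral_mono_AE' 1 ham) simp
  with 1 show "expect_obs \<sigma> k d \<theta> (\<lambda>Y. hamming d (\<eta> Y) (eta k \<theta>)) \<le> 2 * real d * exp (- 2 * L)"
    by linarith
  have [measurable]: "G \<in> borel_measurable M" using G by (auto simp: has_bochner_integral_iff)
  \<comment> \<open>A wrong support costs loss at least 1, which almost surely forces the measurable
    event \<open>2 * G Y \<ge> 1\<close>. Markov's inequality at level 1 then applies.\<close>
  have "prob_obs \<sigma> k d \<theta> (\<lambda>Y. support d (\<eta> Y) \<noteq> support d (eta k \<theta>)) \<le> measure M {Y\<in>space M. 2 * G Y \<ge> 1}"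
    unfolding prob_obs_def M_def[symmetric]
  proof (rule M.finite_measure_mono_AE)
    show "AE Y in M. Y \<in> {Y \<in> space M. support d (\<eta> Y) \<noteq> support d (eta k \<theta>)} \<longrightarrow>
        Y \<in> {Y \<in> space M. 1 \<le> 2 * G Y}"
      using ham
    proof eventually_elim
      case (elim Y)
      then have "1 \<le> 2 * G Y" if "support d (\<eta> Y) \<noteq> support d (eta k \<theta>)"
        using one_le_hamming[OF that] by linarith
      then show ?case by simp
    qed
  qed measurable
  also have "\<dots> \<le> (\<integral>Y. 2 * G Y \<partial>M) / 1"
    using G0 by (intro integral_Markov_inequality_measure[where A = "{}"] 1) auto
  finally show "prob_obs \<sigma> k d \<theta> (\<lambda>Y. support d (\<eta> Y) \<noteq> support d (eta k \<theta>)) \<le> 2 * real d * exp (- 2 * L)"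
    using 1 by linarith
qed

section \<open>Passage to the limit, uniformly over the parameter space\<close>

text \<open>A squeeze: any single member of \<open>A d\<close> keeps the supremum at least 0, and
  the uniform bound \<open>b d\<close> keeps it below a null sequence.\<close>

lemma limsup_SUP_eq_0:
  fixes f :: "nat \<Rightarrow> 'a \<Rightarrow> real"
  assumes "\<forall>\<^sub>F d in sequentially. A d \<noteq> {} \<and> (\<forall>x\<in>A d. 0 \<le> f d x \<and> f d x \<le> b d)"
    and b: "b \<longlonglongrightarrow> 0"
  shows "limsup (\<lambda>d. SUP x\<in>A d. ereal (f d x)) = 0"
proof -
  have 1: "\<forall>\<^sub>F d in sequentially. 0 \<le> (SUP x\<in>A d. ereal (f d x))"
    using assms(1) by eventually_elim (force intro: SUP_upper2)
  have 2: "\<forall>\<^sub>F d in sequentially. (SUP x\<in>A d. ereal (f d x)) \<le> ereal (b d)"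
    using assms(1) by eventually_elim (auto intro: SUP_least)
  have "(\<lambda>d. SUP x\<in>A d. ereal (f d x)) \<longlonglongrightarrow> 0"
    using b by (intro tendsto_sandwich[OF 1 2]) (auto simp: zero_ereal_def)
  then show ?thesis by (simp add: lim_imp_Limsup)
qed

theorem theorem12:
  fixes \<sigma> :: real and s k :: "nat \<Rightarrow> nat" and a :: "nat \<Rightarrow> real"
  assumes "\<sigma> > 0"
    and "\<And>d. d \<ge> 2 \<Longrightarrow> 1 \<le> s d \<and> s d < d \<and> 1 \<le> k d \<and> a d > 0"
  shows
    "((\<forall>\<^sub>F d in sequentially.
         (a d)\<^sup>2 \<ge> \<sigma>\<^sup>2 * (16 * sqrt (real (k d) * ln (real d)) + 80 * ln (real d))) \<longrightarrow>
      (\<forall>\<eta>h \<in> {\<lambda>d. threshold_selector (k d)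
                    (\<sigma>\<^sup>2 * (real (k d) + 4 * ln (real d) + 4 * sqrt (real (k d) * ln (real d)))),
                \<lambda>d. scan_selector (k d) d (s d)}.
         limsup (\<lambda>d. SUP \<theta>\<in>Theta (k d) d (s d) (a d).
           ereal (expect_obs \<sigma> (k d) d \<theta> (\<lambda>Y. hamming d (\<eta>h d Y) (eta (k d) \<theta>)))) = 0 \<and>
         limsup (\<lambda>d. SUP \<theta>\<in>Theta (k d) d (s d) (a d).
           ereal (prob_obs \<sigma> (k d) d \<theta>
             (\<lambda>Y. support d (\<eta>h d Y) \<noteq> support d (eta (k d) \<theta>)))) = 0))
     \<and>
     (filterlim (\<lambda>d. real d / real (s d)) at_top sequentially \<and>
      (\<forall>d\<ge>2. (a d)\<^sup>2 \<ge> \<sigma>\<^sup>2 * (16 * sqrt (real (k d) * ln (real d / real (s d)))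
                                + 80 * ln (real d / real (s d)))) \<longrightarrow>
      (\<forall>\<eta>h \<in> {\<lambda>d. threshold_selector (k d)
                    (\<sigma>\<^sup>2 * (real (k d) + 4 * ln (real d / real (s d))
                          + 4 * sqrt (real (k d) * ln (real d / real (s d))))),
                \<lambda>d. scan_selector (k d) d (s d)}.
         limsup (\<lambda>d. SUP \<theta>\<in>Theta (k d) d (s d) (a d).
           ereal (1 / real (s d) *
             expect_obs \<sigma> (k d) d \<theta> (\<lambda>Y. hamming d (\<eta>h d Y) (eta (k d) \<theta>)))) = 0))"
proof -
  have nonneg: "0 \<le> expect_obs \<sigma> (k d) d \<theta> (\<lambda>Y. hamming d (h Y) (eta (k d) \<theta>))"
      "0 \<le> prob_obs \<sigma> (k d) d \<theta> Q" for d \<theta> h Q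
    by (auto simp: expect_obs_def prob_obs_def hamming_nonneg intro: integral_nonneg)
  have ne: "Theta (k d) d (s d) (a d) \<noteq> {}" if "d \<ge> 2" for d
    using assms(2)[OF that] by (intro Theta_nonempty) auto
  show ?thesis
  proof (intro conjI impI ballI; (elim conjE)?)
    fix \<eta>h
    assume a: "\<forall>\<^sub>F d in sequentially.
         (a d)\<^sup>2 \<ge> \<sigma>\<^sup>2 * (16 * sqrt (real (k d) * ln (real d)) + 80 * ln (real d))"
      and \<eta>h: "\<eta>h \<in> {\<lambda>d. threshold_selector (k d)
                    (\<sigma>\<^sup>2 * (real (k d) + 4 * ln (real d) + 4 * sqrt (real (k d) * ln (real d)))),
                \<lambda>d. scan_selector (k d) d (s d)}"
    \<comment> \<open>For \<open>L = ln d\<close> the risk bound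
      \<open>2 * d * exp (- 2 * L)\<close> equals \<open>2 / d\<close>.\<close>
    have lim: "(\<lambda>d. 2 / real d) \<longlonglongrightarrow> 0"
      by (rule lim_const_over_n)
    have "\<forall>\<^sub>F d in sequentially. \<forall>\<theta>\<in>Theta (k d) d (s d) (a d).
       expect_obs \<sigma> (k d) d \<theta> (\<lambda>Y. hamming d (\<eta>h d Y) (eta (k d) \<theta>)) \<le> 2 / d \<and>
       prob_obs \<sigma> (k d) d \<theta> (\<lambda>Y. support d (\<eta>h d Y) \<noteq> support d (eta (k d) \<theta>)) \<le> 2 / d"
      using a eventually_ge_at_top[of 2]
    proof eventually_elim
      case (elim d)
      have "exp (- 2 * ln (real d)) = 1 / real d ^ 2"
        using elim exp_double[of "ln (real d)"] by (simp add: exp_minus field_simps)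
      then have "2 * real d * exp (- 2 * ln (real d)) = 2 / d"
        using elim by (simp add: power2_eq_square)
      then show ?case
        using selector_risk[where \<sigma> = \<sigma> and k = "k d" and d = d and s = "s d" and a = "a d"
            and L = "ln (real d)" and \<eta> = "\<eta>h d"] assms(1) assms(2)[of d] elim \<eta>h
        by auto
    qed
    then have *: "\<forall>\<^sub>F d in sequentially. Theta (k d) d (s d) (a d) \<noteq> {} \<and> (\<forall>\<theta>\<in>Theta (k d) d (s d) (a d).
       expect_obs \<sigma> (k d) d \<theta> (\<lambda>Y. hamming d (\<eta>h d Y) (eta (k d) \<theta>)) \<le> 2 / d \<and>
       prob_obs \<sigma> (k d) d \<theta> (\<lambda>Y. support d (\<eta>h d Y) \<noteq> support d (eta (k d) \<theta>)) \<le> 2 / d)"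
      using eventually_ge_at_top[of 2] by eventually_elim (use ne in auto)
    show "limsup (\<lambda>d. SUP \<theta>\<in>Theta (k d) d (s d) (a d).
           ereal (expect_obs \<sigma> (k d) d \<theta> (\<lambda>Y. hamming d (\<eta>h d Y) (eta (k d) \<theta>)))) = 0"
      by (rule limsup_SUP_eq_0[OF _ lim], use * in eventually_elim) (auto simp: nonneg)
    show "limsup (\<lambda>d. SUP \<theta>\<in>Theta (k d) d (s d) (a d).
           ereal (prob_obs \<sigma> (k d) d \<theta>
             (\<lambda>Y. support d (\<eta>h d Y) \<noteq> support d (eta (k d) \<theta>)))) = 0"
      by (rule limsup_SUP_eq_0[OF _ lim], use * in eventually_elim) (auto simp: nonneg)
  next
    fix \<eta>h
    assume ds: "filterlim (\<lambda>d. real d / real (s d)) at_top sequentially"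
      and a: "\<forall>d\<ge>2. (a d)\<^sup>2 \<ge> \<sigma>\<^sup>2 * (16 * sqrt (real (k d) * ln (real d / real (s d)))
                                + 80 * ln (real d / real (s d)))"
      and \<eta>h: "\<eta>h \<in> {\<lambda>d. threshold_selector (k d)
                    (\<sigma>\<^sup>2 * (real (k d) + 4 * ln (real d / real (s d))
                          + 4 * sqrt (real (k d) * ln (real d / real (s d))))),
                \<lambda>d. scan_selector (k d) d (s d)}"
    \<comment> \<open>For \<open>L = ln (d/s)\<close> the risk bound is
      \<open>2 * s\<^sup>2 / d\<close>; dividing by \<open>s\<close> leaves
      \<open>2 / (d/s)\<close>.\<close>
    have lim: "(\<lambda>d. 2 / (real d / real (s d))) \<longlonglongrightarrow> 0"
      by (intro real_tendsto_divide_at_top[OF tendsto_const ds])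
    have "\<forall>\<^sub>F d in sequentially. Theta (k d) d (s d) (a d) \<noteq> {} \<and> (\<forall>\<theta>\<in>Theta (k d) d (s d) (a d).
       0 \<le> 1 / real (s d) * expect_obs \<sigma> (k d) d \<theta> (\<lambda>Y. hamming d (\<eta>h d Y) (eta (k d) \<theta>)) \<and>
       1 / real (s d) * expect_obs \<sigma> (k d) d \<theta> (\<lambda>Y. hamming d (\<eta>h d Y) (eta (k d) \<theta>))
         \<le> 2 / (real d / real (s d)))"
      using eventually_ge_at_top[of 2]
    proof (eventually_elim, intro conjI ballI)
      fix d \<theta> assume d: "2 \<le> d" and \<theta>: "\<theta> \<in> Theta (k d) d (s d) (a d)"
      note sd = assms(2)[OF d]
      have "exp (- 2 * ln (real d / real (s d))) = 1 / (real d / real (s d)) ^ 2"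
        using sd exp_double[of "ln (real d / real (s d))"] by (simp add: exp_minus field_simps)
      then have "2 * real d * exp (- 2 * ln (real d / real (s d))) = real (s d) * (2 / (real d / real (s d)))"
        using sd by (simp add: power2_eq_square field_simps)
      moreover have "expect_obs \<sigma> (k d) d \<theta> (\<lambda>Y. hamming d (\<eta>h d Y) (eta (k d) \<theta>))
          \<le> 2 * real d * exp (- 2 * ln (real d / real (s d)))"
        using sd assms(1) a d \<theta> \<eta>h
        by (intro selector_risk(1)[where s = "s d" and a = "a d"]) auto
      ultimately show "1 / real (s d) * expect_obs \<sigma> (k d) d \<theta> (\<lambda>Y. hamming d (\<eta>h d Y) (eta (k d) \<theta>))
         \<le> 2 / (real d / real (s d))"
        using sd by (simp add: pos_divide_le_eq mult.commute)
    qed (simp_all add: ne nonneg)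
    then show "limsup (\<lambda>d. SUP \<theta>\<in>Theta (k d) d (s d) (a d).
           ereal (1 / real (s d) *
             expect_obs \<sigma> (k d) d \<theta> (\<lambda>Y. hamming d (\<eta>h d Y) (eta (k d) \<theta>)))) = 0"
      by (rule limsup_SUP_eq_0[OF _ lim])
  qed
qed

end
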